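(* Let $\varphi:\mathbb{R}^n\to\mathbb{R}$ be differentiable and convex, let $\psi:\mathbb{R}^n\to\mathbb{R}\cup\{\infty\}$ be a closed proper convex function, and let $f:=\varphi+\psi$. Let $\theta_0=1$, $\theta_k\in(0,1]$ and $t_k>0$ for $k=0,1,2,\dots$, let $x_0\in\mathbb{R}^n$, and let $x_k,y_k,g_k$ be the sequences generated by the proximal gradient template (defined in the context). Suppose that the step sizes satisfy the decrease condition $$f(x_{k+1})\le\min_{x\in\mathbb{R}^n}\left\{\varphi(y_k)+\langle\nabla\varphi(y_k),x-y_k\rangle+\frac{1}{2t_k}\|x-y_k\|^2+\psi(x)\right\},\qquad k=0,1,2,\dots$$ For $k=1,2,\dots$ let $$z_k:=\frac{\sum_{i=0}^{k-1}\frac{t_i}{\theta_i}g_i}{\sum_{i=0}^{k-1}\frac{t_i}{\theta_i}}.$$ Then for $k=1,2,\dots$ $$\mathsf{LHS}_k\le -f^*(z_k)+\langle z_k,x_0\rangle-\frac{\sum_{i=0}^{k-1}\frac{t_i}{\theta_i}}{2}\|z_k\|^2,$$ where $\mathsf{LHS}_k$ is as follows, in each of the following two cases: (a) If $\theta_k=1$ for all $k=0,1,\dots$, then $$\mathsf{LHS}_k:=\frac{\sum_{i=0}^{k-1}t_if(x_{i+1})}{\sum_{i=0}^{k-1}t_i}.$$ (b) If $t_k>0$ and $\theta_k\in(0,1]$ are such that $\sum_{i=0}^{k-1}\frac{t_i}{\theta_i}=(1-\theta_k)\sum_{i=0}^{k}\frac{t_i}{\theta_i}$ for all $k=0,1,\dots$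 (an empty sum being $0$), then $$\mathsf{LHS}_k:=f(x_k).$$
   Context: $\mathbb{R}^n$ is endowed with an inner product $\langle\cdot,\cdot\rangle$ and $\|\cdot\|$ is the corresponding Euclidean norm. For a convex function $h:\mathbb{R}^n\to\mathbb{R}\cup\{\infty\}$, the convex conjugate is $h^*(z)=\sup_{x\in\mathbb{R}^n}\{\langle z,x\rangle-h(x)\}$. For $t>0$ the proximal map of $\psi$ is $\mathrm{Prox}_t(x):=\arg\min_{y\in\mathbb{R}^n}\left\{\psi(y)+\frac{1}{2t}\|x-y\|^2\right\}$. Proximal gradient template: given $x_0\in\mathbb{R}^n$, set $y_0:=x_0$ and $\theta_0:=1$; for $k=0,1,2,\dots$, with $t_k>0$ and $\theta_{k+1}\in(0,1]$, set $$x_{k+1}:=\mathrm{Prox}_{t_k}(y_k-t_k\nabla\varphi(y_k)),\qquad y_{k+1}:=x_{k+1}+\frac{\theta_{k+1}(1-\theta_k)}{\theta_k}(x_{k+1}-x_k).$$ The vectors $g_k$ are defined by $x_{k+1}=y_k-t_kg_k$, i.e. $g_k:=(y_k-x_{k+1})/t_k$; by the optimality conditions for the proximal step, $g_k=g_k^\varphi+g_k^\psi$ with $g_k^\varphi=\nabla\varphi(y_k)$ and $g_k^\psi\in\partial\psi(x_{k+1})$. *)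

theory Defs
  imports "HOL-Analysis.Analysis"
begin

text \<open>Functions with values in the reals extended by \<open>\<infinity>\<close> are \<open>ereal\<close>-valued;
  properness excludes the value \<open>-\<infinity>\<close>.\<close>

definition ereal_epigraph :: "('a \<Rightarrow> ereal) \<Rightarrow> ('a \<times> real) set" where
  "ereal_epigraph h = {xr. h (fst xr) \<le> ereal (snd xr)}"

definition proper_fun :: "('a \<Rightarrow> ereal) \<Rightarrow> bool" where
  "proper_fun h \<longleftrightarrow> (\<forall>x. h x \<noteq> -\<infinity>) \<and> (\<exists>x. h x \<noteq> \<infinity>)"

definition convex_fun :: "('a::real_vector \<Rightarrow> ereal) \<Rightarrow> bool" where
  "convex_fun h \<longleftrightarrow> convex (ereal_epigraph h)"

definition closed_fun :: "('a::topological_space \<Rightarrow> ereal) \<Rightarrow> bool" where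
  "closed_fun h \<longleftrightarrow> closed (ereal_epigraph h)"

definition conjugate :: "('a::real_inner \<Rightarrow> ereal) \<Rightarrow> 'a \<Rightarrow> ereal" where
  "conjugate h z = (SUP x. ereal (z \<bullet> x) - h x)"

definition gradient :: "('a::real_inner \<Rightarrow> real) \<Rightarrow> 'a \<Rightarrow> 'a" where
  "gradient \<phi> x = (THE D. GDERIV \<phi> x :> D)"

text \<open>For closed proper convex \<open>\<psi>\<close> and \<open>t > 0\<close> on a Euclidean space the objective below has
  exactly one minimizer, so the choice made by \<^const>\<open>arg_min\<close> is immaterial.\<close>

definition prox :: "('a::real_inner \<Rightarrow> ereal) \<Rightarrow> real \<Rightarrow> 'a \<Rightarrow> 'a" where
  "prox \<psi> t x = (ARG_MIN (\<lambda>y. \<psi> y + ereal (1 / (2 * t) * (norm (x - y))\<^sup>2)) y. True)"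

definition prox_gradient_template ::
    "('a::real_inner \<Rightarrow> real) \<Rightarrow> ('a \<Rightarrow> ereal) \<Rightarrow> (nat \<Rightarrow> real) \<Rightarrow> (nat \<Rightarrow> real) \<Rightarrow> 'a \<Rightarrow>
      (nat \<Rightarrow> 'a) \<Rightarrow> (nat \<Rightarrow> 'a) \<Rightarrow> bool" where
  "prox_gradient_template \<phi> \<psi> t \<theta> x0 x y \<longleftrightarrow>
     x 0 = x0 \<and> y 0 = x0 \<and> \<theta> 0 = 1 \<and>
     (\<forall>k. 0 < \<theta> k \<and> \<theta> k \<le> 1) \<and> (\<forall>k. 0 < t k) \<and>
     (\<forall>k. x (Suc k) = prox \<psi> (t k) (y k - t k *\<^sub>R gradient \<phi> (y k))) \<and>
     (\<forall>k. y (Suc k) =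
        x (Suc k) + (\<theta> (Suc k) * (1 - \<theta> k) / \<theta> k) *\<^sub>R (x (Suc k) - x k))"

end

theory Submission
  imports Defs
begin

text \<open>The decrease condition bounds the proximal objective from below, so by strong convexity it
  has a minimizer and grows quadratically around it. Together with the gradient inequality for
  \<open>\<phi>\<close> this gives \<open>f (x (Suc k)) + g k \<bullet> (u - y k) + t k / 2 * (norm (g k))\<^sup>2 \<le> f u\<close> for all \<open>u\<close>.
  Taking the weights \<open>1 - \<theta> k\<close> at \<open>x k\<close> and \<open>\<theta> k\<close> at \<open>u\<close>, and writing
  \<open>w k = x0 - (\<Sum>i<k. (t i / \<theta> i) *\<^sub>R g i)\<close>, the gap to \<open>f u\<close>, suitably weighted, is at most the
  telescoping difference of \<open>(norm (w k - u))\<^sup>2 / 2\<close>. Since \<open>w k = x0 - T *\<^sub>R z k\<close>, where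
  \<open>T = (\<Sum>i<k. t i / \<theta> i)\<close>, expanding the square and taking the infimum over \<open>u\<close> produces
  the conjugate.\<close>

section \<open>Quadratic perturbations of closed convex epigraphs\<close>

lemma norm_sq_convex_combination:
  fixes a b :: "'a::real_inner"
  shows "(norm ((1 - s) *\<^sub>R a + s *\<^sub>R b))\<^sup>2
           = (1 - s) * (norm a)\<^sup>2 + s * (norm b)\<^sup>2 - s * (1 - s) * (norm (a - b))\<^sup>2"
  unfolding power2_norm_eq_inner
  by (simp add: algebra_simps inner_commute)

lemma norm_sq_diff_scaleR:
  fixes a b :: "'a::real_inner"
  shows "(norm (a - s *\<^sub>R b))\<^sup>2 = (norm a)\<^sup>2 - 2 * s * (a \<bullet> b) + s\<^sup>2 * (norm b)\<^sup>2"
  unfolding power2_norm_eq_inner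
  by (simp add: algebra_simps inner_commute power2_eq_square)

text \<open>Strong convexity of \<open>(u, a)\<close> \<mapsto>
  \<open>a + c * (norm (w - u))\<^sup>2\<close> along a convex set; the witness is the convex
  combination itself. With an epigraph as \<open>E\<close>, no infinite value enters the
  computation.\<close>

lemma convex_set_quadratic_combination:
  fixes w u v :: "'a::real_inner"
  assumes "convex E" "(u, a) \<in> E" "(v, b) \<in> E" "0 \<le> s" "s \<le> 1"
  shows "\<exists>p d. (p, d) \<in> E \<and> d + c * (norm (w - p))\<^sup>2
           = (1 - s) * (a + c * (norm (w - u))\<^sup>2) + s * (b + c * (norm (w - v))\<^sup>2)
             - c * (s * (1 - s) * (norm (u - v))\<^sup>2)"
proof (intro exI conjI)
  show "((1 - s) *\<^sub>R u + s *\<^sub>R v, (1 - s) * a + s * b) \<in> E"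
    using convexD_alt[OF assms(1-3), of s] assms(4,5) by simp
  have "w - ((1 - s) *\<^sub>R u + s *\<^sub>R v) = (1 - s) *\<^sub>R (w - u) + s *\<^sub>R (w - v)"
    by (simp add: algebra_simps)
  then have "(norm (w - ((1 - s) *\<^sub>R u + s *\<^sub>R v)))\<^sup>2
      = (1 - s) * (norm (w - u))\<^sup>2 + s * (norm (w - v))\<^sup>2 - s * (1 - s) * (norm (u - v))\<^sup>2"
    using norm_sq_convex_combination[of s "w - u" "w - v"] by (simp add: norm_minus_commute)
  then show "(1 - s) * a + s * b + c * (norm (w - ((1 - s) *\<^sub>R u + s *\<^sub>R v)))\<^sup>2
      = (1 - s) * (a + c * (norm (w - u))\<^sup>2) + s * (b + c * (norm (w - v))\<^sup>2)
             - c * (s * (1 - s) * (norm (u - v))\<^sup>2)"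
    by (simp only:) (simp add: algebra_simps)
qed

text \<open>The direct method: strong convexity makes every minimizing sequence Cauchy, completeness
  supplies the limit, and closedness of \<open>E\<close> keeps it in \<open>E\<close>.\<close>

lemma quadratic_minimizer_exists:
  fixes E :: "('a::{real_inner,complete_space} \<times> real) set"
  assumes "closed E" "convex E" "E \<noteq> {}" "c > 0"
    and lower: "\<And>u a. (u, a) \<in> E \<Longrightarrow> m \<le> a + c * (norm (w - u))\<^sup>2"
  obtains p b where "(p, b) \<in> E"
    "\<And>u a. (u, a) \<in> E \<Longrightarrow> b + c * (norm (w - p))\<^sup>2 \<le> a + c * (norm (w - u))\<^sup>2"
proof -
  define Q where "Q = (\<lambda>(u, a). a + c * (norm (w - u))\<^sup>2)"
  define I where "I = Inf (Q ` E)"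
  have bdd: "bdd_below (Q ` E)"
    using lower by (intro bdd_belowI2[of _ m]) (auto simp: Q_def)
  have I_le: "I \<le> a + c * (norm (w - u))\<^sup>2" if "(u, a) \<in> E" for u a
    using cINF_lower[OF bdd that] by (simp add: I_def Q_def)
  have "\<exists>e\<in>E. Q e < I + 1 / Suc n" for n
    using cInf_lessD[of "Q ` E" "I + 1 / Suc n"] assms(3) by (auto simp: I_def)
  then obtain e where e: "\<And>n. e n \<in> E" "\<And>n. Q (e n) < I + 1 / Suc n"
    by metis
  define v r where "v n = fst (e n)" and "r n = snd (e n)" for n
  have vr: "(v n, r n) \<in> E" "r n + c * (norm (w - v n))\<^sup>2 < I + 1 / Suc n" for n
    using e[of n] by (auto simp: v_def r_def Q_def split: prod.splits)
  have gap: "c * (norm (v i - v j))\<^sup>2 \<le> 2 * (1 / Suc i + 1 / Suc j)" for i j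
  proof -
    \<comment> \<open>The midpoint of two near-minimizers lies in \<open>E\<close>, so its value is
      at least \<open>I\<close>. A quarter of \<open>c\<close> times their squared distance is thus
      at most the average of their excesses over \<open>I\<close>.\<close>
    have "I \<le> (1/2) * (r i + c * (norm (w - v i))\<^sup>2) + (1/2) * (r j + c * (norm (w - v j))\<^sup>2)
             - (c * (norm (v i - v j))\<^sup>2) / 4"
      using convex_set_quadratic_combination[OF assms(2) vr(1)[of i] vr(1)[of j], of "1/2" c w]
        I_le by force
    then show ?thesis
      using vr(2)[of i] vr(2)[of j] by argo
  qed
  have "Cauchy v"
  proof (rule CauchyI)
    fix \<epsilon> :: real assume "\<epsilon> > 0"
    then obtain N where N: "1 / Suc N < c * \<epsilon>\<^sup>2 / 4"
      using \<open>c > 0\<close> nat_approx_posE[of "c * \<epsilon>\<^sup>2 / 4"] by auto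
    have "norm (v i - v j) < \<epsilon>" if "i \<ge> N" "j \<ge> N" for i j
    proof -
      have "1 / real (Suc i) \<le> 1 / Suc N" "1 / real (Suc j) \<le> 1 / Suc N"
        using that by (auto intro!: divide_left_mono)
      then have "1 / real (Suc i) + 1 / real (Suc j) < c * \<epsilon>\<^sup>2 / 2"
        using N by linarith
      then have "c * (norm (v i - v j))\<^sup>2 < c * \<epsilon>\<^sup>2"
        using gap[of i j] by argo
      then have "(norm (v i - v j))\<^sup>2 < \<epsilon>\<^sup>2"
        using \<open>c > 0\<close> by simp
      then show ?thesis
        using \<open>\<epsilon> > 0\<close> by (simp add: power_less_imp_less_base)
    qed
    then show "\<exists>M. \<forall>m\<ge>M. \<forall>n\<ge>M. norm (v m - v n) < \<epsilon>" by blast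
  qed
  then obtain p where p: "v \<longlonglongrightarrow> p"
    using Cauchy_convergent convergent_def by blast
  have "(\<lambda>n. r n + c * (norm (w - v n))\<^sup>2) \<longlonglongrightarrow> I"
  proof (rule tendsto_sandwich)
    show "\<forall>\<^sub>F n in sequentially. I \<le> r n + c * (norm (w - v n))\<^sup>2"
      using I_le vr(1) by auto
    show "\<forall>\<^sub>F n in sequentially. r n + c * (norm (w - v n))\<^sup>2 \<le> I + 1 / Suc n"
      using vr(2) by (intro always_eventually allI less_imp_le)
    show "(\<lambda>n. I + 1 / real (Suc n)) \<longlonglongrightarrow> I"
      using tendsto_add[OF tendsto_const LIMSEQ_Suc[OF lim_1_over_n]] by simp
  qed simp
  moreover have "(\<lambda>n. c * (norm (w - v n))\<^sup>2) \<longlonglongrightarrow> c * (norm (w - p))\<^sup>2"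
    by (intro tendsto_intros p)
  \<comment> \<open>The heights \<open>r n\<close> converge as a difference: the objective tends to
    \<open>I\<close>, and its quadratic part converges along with \<open>v\<close>.\<close>
  ultimately have "r \<longlonglongrightarrow> I - c * (norm (w - p))\<^sup>2"
    using tendsto_diff by fastforce
  then have "(\<lambda>n. (v n, r n)) \<longlonglongrightarrow> (p, I - c * (norm (w - p))\<^sup>2)"
    by (intro tendsto_Pair p)
  then have "(p, I - c * (norm (w - p))\<^sup>2) \<in> E"
    by (rule closed_sequentially[OF \<open>closed E\<close> vr(1)])
  then show ?thesis
    using I_le by (intro that) auto
qed

text \<open>Compare the minimizer with the point reached by moving the fraction \<open>1 - r\<close>
  of the way to \<open>u\<close>; divide the strong convexity inequality by \<open>1 - r\<close> and
  let \<open>r\<close> tend to 1.\<close>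

lemma quadratic_growth_at_minimizer:
  fixes E :: "('a::real_inner \<times> real) set"
  assumes "convex E" "(p, b) \<in> E" "(u, a) \<in> E"
    and min: "\<And>u a. (u, a) \<in> E \<Longrightarrow> b + c * (norm (w - p))\<^sup>2 \<le> a + c * (norm (w - u))\<^sup>2"
  shows "b + c * (norm (w - p))\<^sup>2 + c * (norm (u - p))\<^sup>2 \<le> a + c * (norm (w - u))\<^sup>2"
proof -
  define K L D where "K = b + c * (norm (w - p))\<^sup>2" and "L = a + c * (norm (w - u))\<^sup>2"
    and "D = c * (norm (u - p))\<^sup>2"
  have "r * D \<le> L - K" if "0 < r" "r < 1" for r
  proof -
    have "K \<le> (1 - (1 - r)) * K + (1 - r) * L - c * ((1 - r) * (1 - (1 - r)) * (norm (p - u))\<^sup>2)"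
      using convex_set_quadratic_combination[OF assms(1-3), of "1 - r" c w] min that
      unfolding K_def L_def by force
    then have "(1 - r) * (r * D) \<le> (1 - r) * (L - K)"
      by (simp add: D_def norm_minus_commute algebra_simps)
    then show ?thesis
      using that by simp
  qed
  then have "D \<le> L - K"
    by (rule field_le_mult_one_interval)
  then show ?thesis
    by (simp add: K_def L_def D_def)
qed

section \<open>The proximal map and the gradient\<close>

text \<open>This inequality stands in for the optimality condition on a subgradient of
  \<open>\<psi>\<close> at \<open>p\<close>. The bound \<open>m\<close> makes the infimum finite and
  is later read off from the decrease condition.\<close>

lemma prox_growth:
  fixes \<psi> :: "'a::{real_inner,complete_space} \<Rightarrow> ereal"
  assumes "closed_fun \<psi>" "proper_fun \<psi>" "convex_fun \<psi>" "0 < t"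
    and lower: "\<And>u. ereal m \<le> \<psi> u + ereal (1 / (2 * t) * (norm (w - u))\<^sup>2)"
  defines "p \<equiv> prox \<psi> t w"
  shows "\<psi> p + ereal (1 / (2 * t) * (norm (w - p))\<^sup>2 + 1 / (2 * t) * (norm (u - p))\<^sup>2)
           \<le> \<psi> u + ereal (1 / (2 * t) * (norm (w - u))\<^sup>2)"
proof -
  define E where "E = ereal_epigraph \<psi>"
  define c where "c = 1 / (2 * t)"
  have "c > 0" using \<open>0 < t\<close> by (simp add: c_def)
  have E_iff: "(u, a) \<in> E \<longleftrightarrow> \<psi> u \<le> ereal a" for u a
    by (simp add: E_def ereal_epigraph_def)
  have cl: "closed E" and cv: "convex E"
    using assms(1,3) by (simp_all add: E_def closed_fun_def convex_fun_def)
  have nm: "\<psi> u \<noteq> -\<infinity>" for u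
    using assms(2) by (simp add: proper_fun_def)
  obtain u0 where "\<psi> u0 \<noteq> \<infinity>"
    using assms(2) by (auto simp: proper_fun_def)
  then have "E \<noteq> {}"
    using nm[of u0] E_iff[of u0] by (cases "\<psi> u0") auto
  moreover have "m \<le> a + c * (norm (w - u))\<^sup>2" if "(u, a) \<in> E" for u a
  proof -
    have "ereal m \<le> ereal a + ereal (c * (norm (w - u))\<^sup>2)"
      using lower[of u] that[unfolded E_iff] unfolding c_def
      by (meson add_right_mono order_trans)
    then show ?thesis by simp
  qed
  ultimately obtain q b where q: "(q, b) \<in> E"
    "\<And>u a. (u, a) \<in> E \<Longrightarrow> b + c * (norm (w - q))\<^sup>2 \<le> a + c * (norm (w - u))\<^sup>2"
    using quadratic_minimizer_exists[OF cl cv _ \<open>c > 0\<close>] by blast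
  define F where "F = (\<lambda>u. \<psi> u + ereal (c * (norm (w - u))\<^sup>2))"
  have Fq: "F q \<le> F u" for u
  proof (cases "\<psi> u")
    case (real a)
    then have "b + c * (norm (w - q))\<^sup>2 \<le> a + c * (norm (w - u))\<^sup>2"
      by (intro q(2)) (simp add: E_iff)
    moreover have "F q \<le> ereal b + ereal (c * (norm (w - q))\<^sup>2)"
      unfolding F_def using q(1) by (intro add_right_mono) (simp add: E_iff)
    ultimately show ?thesis
      by (simp add: F_def real) (metis ereal_less_eq(3) order_trans)
  qed (use nm in \<open>auto simp: F_def\<close>)
  then have "is_arg_min F (\<lambda>_. True) q"
    by (auto simp: is_arg_min_def not_less)
  \<comment> \<open>\<open>ARG_MIN\<close> is a Hilbert choice, so the existence of the minimizer
    \<open>q\<close> already shows that the chosen point \<open>p\<close> minimizes.\<close>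
  then have "is_arg_min F (\<lambda>_. True) p"
    unfolding p_def prox_def arg_min_def F_def c_def by (rule someI)
  then have Fp: "F p \<le> F u" for u
    by (auto simp: is_arg_min_def not_less)
  obtain b' where b': "\<psi> p = ereal b'"
    using Fp[of q] nm[of p] q(1) by (cases "\<psi> p"; cases "\<psi> q") (auto simp: F_def E_iff)
  show ?thesis
  proof (cases "\<psi> u")
    case (real a)
    have "b' + c * (norm (w - p))\<^sup>2 + c * (norm (u - p))\<^sup>2 \<le> a + c * (norm (w - u))\<^sup>2"
    proof (rule quadratic_growth_at_minimizer[OF cv])
      fix v d assume "(v, d) \<in> E"
      then have "F p \<le> ereal d + ereal (c * (norm (w - v))\<^sup>2)"
        using Fp[of v] unfolding F_def E_iff by (meson add_right_mono order_trans)
      then show "b' + c * (norm (w - p))\<^sup>2 \<le> d + c * (norm (w - v))\<^sup>2"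
        by (simp add: F_def b')
    qed (simp_all add: E_iff b' real)
    then show ?thesis
      unfolding c_def[symmetric] by (simp add: b' real)
  qed (use nm in auto)
qed

text \<open>\<open>gradient\<close> is a definite description: existence is Riesz representation,
  with the adjoint of the derivative at 1 as representing vector, and uniqueness is that of the
  derivative.\<close>

lemma GDERIV_gradient:
  fixes \<phi> :: "'a::euclidean_space \<Rightarrow> real"
  assumes "\<phi> differentiable (at x)"
  shows "GDERIV \<phi> x :> gradient \<phi> x"
proof -
  obtain D where D: "(\<phi> has_derivative D) (at x)"
    using assms by (auto simp: differentiable_def)
  then have lin: "linear D"
    by (rule has_derivative_linear)
  have "D = (\<lambda>h. h \<bullet> adjoint D 1)"
    using adjoint_works[OF lin, of _ 1] by (simp add: fun_eq_iff inner_commute)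
  then have ex: "GDERIV \<phi> x :> adjoint D 1"
    using D unfolding gderiv_def by simp
  have "D1 = D2" if "GDERIV \<phi> x :> D1" "GDERIV \<phi> x :> D2" for D1 D2
  proof -
    have "(\<lambda>h. h \<bullet> D1) = (\<lambda>h. h \<bullet> D2)"
      using that unfolding gderiv_def by (rule has_derivative_unique)
    then show ?thesis
      by (metis inner_commute vector_eq_ldot)
  qed
  with ex show ?thesis
    unfolding gradient_def by (metis theI)
qed

text \<open>Restrict \<open>\<phi>\<close> to the line through \<open>y\<close> and \<open>u\<close>
  and use the tangent inequality for convex functions of one variable.\<close>

lemma convex_above_gradient:
  fixes \<phi> :: "'a::euclidean_space \<Rightarrow> real"
  assumes "\<phi> differentiable (at y)" "convex_on UNIV \<phi>"
  shows "\<phi> y + gradient \<phi> y \<bullet> (u - y) \<le> \<phi> u"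
proof -
  define h where "h s = \<phi> (y + s *\<^sub>R (u - y))" for s
  have "convex_on UNIV h"
  proof (rule convex_onI)
    fix s a b :: real assume s: "0 < s" "s < 1"
    have "y + ((1 - s) * a + s * b) *\<^sub>R (u - y)
        = (1 - s) *\<^sub>R (y + a *\<^sub>R (u - y)) + s *\<^sub>R (y + b *\<^sub>R (u - y))"
      by (simp add: algebra_simps)
    then show "h ((1 - s) *\<^sub>R a + s *\<^sub>R b) \<le> (1 - s) * h a + s * h b"
      using convex_onD[OF assms(2), of s] s by (simp add: h_def)
  qed simp
  moreover have "(h has_real_derivative gradient \<phi> y \<bullet> (u - y)) (at 0)"
  proof -
    have "((\<lambda>s. y + s *\<^sub>R (u - y)) has_derivative (\<lambda>s. s *\<^sub>R (u - y))) (at 0)"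
      by (auto intro!: derivative_eq_intros)
    moreover have "(\<phi> has_derivative (\<lambda>h. h \<bullet> gradient \<phi> y)) (at (y + 0 *\<^sub>R (u - y)))"
      using GDERIV_gradient[OF assms(1)] by (simp add: gderiv_def)
    ultimately have "((\<lambda>s. \<phi> (y + s *\<^sub>R (u - y))) has_derivative
        (\<lambda>s. (s *\<^sub>R (u - y)) \<bullet> gradient \<phi> y)) (at 0)"
      by (rule has_derivative_compose)
    then show ?thesis
      unfolding has_field_derivative_def h_def
      by (simp add: inner_commute mult.commute[of _ "inner _ _"])
  qed
  ultimately have "h 1 - h 0 \<ge> gradient \<phi> y \<bullet> (u - y) * (1 - 0)"
    by (intro convex_on_imp_above_tangent[where A = UNIV and c = 0]) auto
  then show ?thesis
    by (simp add: h_def)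
qed

section \<open>The inequality for a single proximal gradient step\<close>

text \<open>Since \<open>u - y = (u - p) - t *\<^sub>R g\<close>, the second claim says that
  \<open>g\<close> is an approximate subgradient of \<open>f\<close> at \<open>p\<close> with error
  \<open>t / 2 * (norm g)\<^sup>2\<close>.\<close>

lemma prox_gradient_step:
  fixes \<phi> :: "'a::euclidean_space \<Rightarrow> real"
  assumes "\<phi> differentiable (at y)" "convex_on UNIV \<phi>"
    and "closed_fun \<psi>" "proper_fun \<psi>" "convex_fun \<psi>" "0 < t"
    and f_def: "f = (\<lambda>u. ereal (\<phi> u) + \<psi> u)"
    and p: "p = prox \<psi> t (y - t *\<^sub>R gradient \<phi> y)"
    and g: "g = (y - p) /\<^sub>R t"
    and decrease: "f p \<le> (INF u. ereal (\<phi> y + gradient \<phi> y \<bullet> (u - y)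
                         + 1 / (2 * t) * (norm (u - y))\<^sup>2) + \<psi> u)"
  shows "\<bar>f p\<bar> \<noteq> \<infinity>" and "f p + ereal (g \<bullet> (u - y) + t / 2 * (norm g)\<^sup>2) \<le> f u"
proof -
  define d where "d = gradient \<phi> y"
  define w where "w = y - t *\<^sub>R d"
  have nm: "\<psi> u \<noteq> -\<infinity>" for u
    using assms(4) by (simp add: proper_fun_def)
  obtain u0 where u0: "\<psi> u0 \<noteq> \<infinity>"
    using assms(4) by (auto simp: proper_fun_def)
  have dec: "f p \<le> ereal (\<phi> y + d \<bullet> (u - y) + 1 / (2 * t) * (norm (u - y))\<^sup>2) + \<psi> u" for u
    using decrease unfolding d_def le_INF_iff by blast
  \<comment> \<open>At \<open>u0\<close>, where \<open>\<psi>\<close> is finite, the decrease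
    condition bounds \<open>f p\<close> by a real number.\<close>
  show fin: "\<bar>f p\<bar> \<noteq> \<infinity>"
    using dec[of u0] u0 nm[of u0] nm[of p] unfolding f_def
    by (cases "\<psi> u0"; cases "\<psi> p") auto
  obtain b where b: "\<psi> p = ereal b"
    using fin unfolding f_def by (cases "\<psi> p") auto
  \<comment> \<open>Completing the square: the proximal objective at \<open>w\<close> and the model
    in the decrease condition differ by a constant in \<open>u\<close>.\<close>
  have sq: "1 / (2 * t) * (norm (w - u))\<^sup>2
      = 1 / (2 * t) * (norm (u - y))\<^sup>2 + d \<bullet> (u - y) + t / 2 * (norm d)\<^sup>2" for u
  proof -
    have eq: "w - u = (y - u) - t *\<^sub>R d"
      by (simp add: w_def)
    have "(norm (w - u))\<^sup>2 = (norm (u - y))\<^sup>2 + 2 * t * (d \<bullet> (u - y)) + t\<^sup>2 * (norm d)\<^sup>2"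
      unfolding eq norm_sq_diff_scaleR norm_minus_commute[of y u]
      by (simp add: algebra_simps inner_commute)
    then show ?thesis
      using \<open>0 < t\<close> by (simp add: add_divide_distrib power2_eq_square)
  qed
  have "ereal (\<phi> p + b - \<phi> y + t / 2 * (norm d)\<^sup>2) \<le> \<psi> u + ereal (1 / (2 * t) * (norm (w - u))\<^sup>2)" for u
    using dec[of u] nm[of u] unfolding f_def b sq by (cases "\<psi> u") auto
  from prox_growth[OF assms(3-6) this, of u, folded p[folded d_def, folded w_def]]
  have gr: "\<psi> p + ereal (1 / (2 * t) * (norm (w - p))\<^sup>2 + 1 / (2 * t) * (norm (u - p))\<^sup>2)
           \<le> \<psi> u + ereal (1 / (2 * t) * (norm (w - u))\<^sup>2)" .
  show "f p + ereal (g \<bullet> (u - y) + t / 2 * (norm g)\<^sup>2) \<le> f u"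
  proof (cases "\<psi> u")
    case (real a)
    have eq: "u - p = (u - y) - (- t) *\<^sub>R g"
      using \<open>0 < t\<close> by (simp add: g)
    have "(norm (u - p))\<^sup>2 = (norm (u - y))\<^sup>2 + 2 * t * (g \<bullet> (u - y)) + t\<^sup>2 * (norm g)\<^sup>2"
      unfolding eq norm_sq_diff_scaleR by (simp add: inner_commute)
    then have "1 / (2 * t) * (norm (u - p))\<^sup>2
        = 1 / (2 * t) * (norm (u - y))\<^sup>2 + g \<bullet> (u - y) + t / 2 * (norm g)\<^sup>2"
      using \<open>0 < t\<close> by (simp add: add_divide_distrib power2_eq_square)
    moreover have "b + 1 / (2 * t) * (norm (p - y))\<^sup>2 + d \<bullet> (p - y) + 1 / (2 * t) * (norm (u - p))\<^sup>2
        \<le> a + 1 / (2 * t) * (norm (u - y))\<^sup>2 + d \<bullet> (u - y)"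
      using gr unfolding sq b real by simp
    \<comment> \<open>The decrease condition at \<open>u = p\<close>, where the finite value of
      \<open>\<psi>\<close> cancels, is the usual descent inequality for
      \<open>\<phi>\<close>.\<close>
    moreover have "\<phi> p \<le> \<phi> y + d \<bullet> (p - y) + 1 / (2 * t) * (norm (p - y))\<^sup>2"
      using dec[of p] by (simp add: f_def b)
    moreover have "\<phi> y + d \<bullet> (u - y) \<le> \<phi> u"
      unfolding d_def by (rule convex_above_gradient[OF assms(1,2)])
    \<comment> \<open>On adding the four facts, the squared distances and all inner products with
      \<open>d\<close> cancel.\<close>
    ultimately show ?thesis
      by (simp add: f_def b real)
  qed (use nm in \<open>auto simp: f_def\<close>)
qed

section \<open>The conjugate as an infimum, and the iteration in interpolation form\<close>

text \<open>The negated conjugate is the infimum of \<open>f u - z \<bullet> u\<close>; points with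
  \<open>f u = \<infinity>\<close> contribute the value \<open>-\<infinity>\<close> to the supremum
  and impose no condition.\<close>

lemma le_uminus_conjugate:
  assumes "\<And>u. f u \<noteq> -\<infinity>"
    and "\<And>u r. f u = ereal r \<Longrightarrow> L \<le> r - z \<bullet> u + c"
  shows "ereal L \<le> - conjugate f z + ereal c"
proof -
  have "conjugate f z \<le> ereal (c - L)"
    unfolding conjugate_def
  proof (rule SUP_least)
    fix u show "ereal (z \<bullet> u) - f u \<le> ereal (c - L)"
      using assms(1)[of u] assms(2)[of u] by (cases "f u") auto
  qed
  then show ?thesis
    by (cases "conjugate f z") auto
qed

text \<open>The momentum rule says that the next \<open>y\<close> interpolates between the next
  \<open>x\<close> and the next term of the auxiliary sequence \<open>w\<close>. Inductively,
  \<open>w (Suc k)\<close> is the extrapolation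
  \<open>x k + (1 / \<theta> k) *\<^sub>R (x (Suc k) - x k)\<close>.\<close>

lemma template_interpolation:
  assumes "prox_gradient_template \<phi> \<psi> t \<theta> x0 x y"
    and g: "\<And>k. g k = (y k - x (Suc k)) /\<^sub>R t k"
  shows "y k = (1 - \<theta> k) *\<^sub>R x k + \<theta> k *\<^sub>R (x0 - (\<Sum>i<k. (t i / \<theta> i) *\<^sub>R g i))"
proof (induction k)
  case 0
  then show ?case
    using assms(1) by (simp add: prox_gradient_template_def)
next
  case (Suc k)
  define w where "w k = x0 - (\<Sum>i<k. (t i / \<theta> i) *\<^sub>R g i)" for k
  have pos: "0 < \<theta> k" "0 < t k"
    and y: "y (Suc k) = x (Suc k) + (\<theta> (Suc k) * (1 - \<theta> k) / \<theta> k) *\<^sub>R (x (Suc k) - x k)"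
    using assms(1) by (auto simp: prox_gradient_template_def)
  have "w (Suc k) = w k - (1 / \<theta> k) *\<^sub>R (y k - x (Suc k))"
    using pos by (simp add: w_def g)
  also have "y k = (1 - \<theta> k) *\<^sub>R x k + \<theta> k *\<^sub>R w k"
    using Suc by (simp add: w_def)
  finally have "w (Suc k) = x (Suc k) + ((1 - \<theta> k) / \<theta> k) *\<^sub>R (x (Suc k) - x k)"
    using pos by (simp add: algebra_simps diff_divide_distrib)
  then have "\<theta> (Suc k) *\<^sub>R (w (Suc k) - x (Suc k)) = y (Suc k) - x (Suc k)"
    unfolding y by simp
  then have "(1 - \<theta> (Suc k)) *\<^sub>R x (Suc k) + \<theta> (Suc k) *\<^sub>R w (Suc k) = y (Suc k)"
    by (simp add: algebra_simps)
  then show ?case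
    by (simp add: w_def)
qed

section \<open>Telescoping over the steps in both cases\<close>

theorem theorem1:
  fixes \<phi> :: "'a::euclidean_space \<Rightarrow> real"
    and \<psi> f :: "'a \<Rightarrow> ereal"
    and t \<theta> :: "nat \<Rightarrow> real"
    and x0 :: 'a
    and x y g z :: "nat \<Rightarrow> 'a"
  assumes "\<phi> differentiable_on UNIV"
    and "convex_on UNIV \<phi>"
    and "closed_fun \<psi>" and "proper_fun \<psi>" and "convex_fun \<psi>"
    and f_def: "f = (\<lambda>u. ereal (\<phi> u) + \<psi> u)"
    and template: "prox_gradient_template \<phi> \<psi> t \<theta> x0 x y"
    and g_def: "\<And>k. g k = (y k - x (Suc k)) /\<^sub>R t k"
    and decrease: "\<And>k. f (x (Suc k)) \<le>
          (INF u. ereal (\<phi> (y k) + gradient \<phi> (y k) \<bullet> (u - y k)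
                         + 1 / (2 * t k) * (norm (u - y k))\<^sup>2) + \<psi> u)"
    and z_def: "\<And>k. 1 \<le> k \<Longrightarrow>
          z k = (\<Sum>i<k. (t i / \<theta> i) *\<^sub>R g i) /\<^sub>R (\<Sum>i<k. t i / \<theta> i)"
  shows "((\<forall>k. \<theta> k = 1) \<longrightarrow>
            (\<forall>k\<ge>1. (\<Sum>i<k. ereal (t i) * f (x (Suc i))) / ereal (\<Sum>i<k. t i)
               \<le> - conjugate f (z k)
                  + ereal (z k \<bullet> x0 - (\<Sum>i<k. t i / \<theta> i) / 2 * (norm (z k))\<^sup>2)))
       \<and> ((\<forall>k. (\<Sum>i<k. t i / \<theta> i) = (1 - \<theta> k) * (\<Sum>i\<le>k. t i / \<theta> i)) \<longrightarrow>
            (\<forall>k\<ge>1. f (x k)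
               \<le> - conjugate f (z k)
                  + ereal (z k \<bullet> x0 - (\<Sum>i<k. t i / \<theta> i) / 2 * (norm (z k))\<^sup>2)))"
proof -
  have pos: "0 < \<theta> k" "\<theta> k \<le> 1" "0 < t k" and \<theta>0: "\<theta> 0 = 1" for k
    using template by (auto simp: prox_gradient_template_def)
  define w where "w k = x0 - (\<Sum>i<k. (t i / \<theta> i) *\<^sub>R g i)" for k
  define T where "T k = (\<Sum>i<k. t i / \<theta> i)" for k
  \<comment> \<open>If \<open>f x0\<close> is infinite, \<open>F 0\<close> is the default value 0;
    for positive indices \<open>F\<close> is the true value of \<open>f\<close>.\<close>
  define F where "F k = real_of_ereal (f (x k))" for k
  have nm: "f u \<noteq> -\<infinity>" for u
    using assms(4) by (cases "\<psi> u") (auto simp: f_def proper_fun_def)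
  have "\<phi> differentiable (at u)" for u
    using assms(1) by (auto simp: differentiable_on_def)
  note step = prox_gradient_step[OF this assms(2-5) pos(3) f_def _ g_def decrease]
  have "x (Suc k) = prox \<psi> (t k) (y k - t k *\<^sub>R gradient \<phi> (y k))" for k
    using template by (auto simp: prox_gradient_template_def)
  note step = step[OF this]
  have F: "f (x (Suc k)) = ereal (F (Suc k))" for k
    using step(1)[of k] by (auto simp: F_def ereal_real)
  have F_step: "F (Suc k) + g k \<bullet> (u - y k) + t k / 2 * (norm (g k))\<^sup>2 \<le> r"
    if "f u = ereal r" for k u r
    using step(2)[of k u] by (simp add: F that)
  have w_Suc: "w (Suc k) = w k - (t k / \<theta> k) *\<^sub>R g k" for k
    by (simp add: w_def)
  have y: "y k = (1 - \<theta> k) *\<^sub>R x k + \<theta> k *\<^sub>R w k" for k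
    unfolding w_def by (rule template_interpolation[OF template g_def])
  have w_gap: "(norm (w k - u))\<^sup>2 / 2 - (norm (w (Suc k) - u))\<^sup>2 / 2
      = t k / \<theta> k * (g k \<bullet> (w k - u)) - (t k / \<theta> k)\<^sup>2 / 2 * (norm (g k))\<^sup>2" for k u
  proof -
    have eq: "w (Suc k) - u = (w k - u) - (t k / \<theta> k) *\<^sub>R g k"
      by (simp add: w_Suc)
    show ?thesis
      unfolding eq norm_sq_diff_scaleR inner_commute[of "w k - u"]
        by (simp add: diff_divide_distrib add_divide_distrib)
  qed
  have T_pos: "0 < T k" if "k \<ge> 1" for k
    unfolding T_def using that pos by (intro sum_pos) (auto simp: lessThan_empty_iff)
  have wz: "w k = x0 - T k *\<^sub>R z k" if "k \<ge> 1" for k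
    using z_def[OF that] T_pos[OF that] by (simp add: w_def T_def)
  \<comment> \<open>The final step common to both cases: substituting
    \<open>w k = x0 - T k *\<^sub>R z k\<close> cancels the square of \<open>norm (x0 - u)\<close>,
    and division by \<open>T k\<close> leaves terms affine in \<open>u\<close>.\<close>
  have conj: "ereal L \<le> - conjugate f (z k) + ereal (z k \<bullet> x0 - T k / 2 * (norm (z k))\<^sup>2)"
    if k: "k \<ge> 1"
      and L: "\<And>u r. f u = ereal r \<Longrightarrow>
        T k * (L - r) \<le> (norm (x0 - u))\<^sup>2 / 2 - (norm (w k - u))\<^sup>2 / 2" for k L
  proof (rule le_uminus_conjugate[OF nm])
    fix u r assume "f u = ereal r"
    then have "T k * (L - r) \<le> (norm (x0 - u))\<^sup>2 / 2 - (norm (w k - u))\<^sup>2 / 2"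
      by (rule L)
    also have "\<dots> = T k * (z k \<bullet> x0 - z k \<bullet> u - T k / 2 * (norm (z k))\<^sup>2)"
    proof -
      have eq: "w k - u = (x0 - u) - T k *\<^sub>R z k"
        by (simp add: wz[OF k])
      show ?thesis
        unfolding eq norm_sq_diff_scaleR inner_commute[of "x0 - u"]
        by (simp add: algebra_simps diff_divide_distrib add_divide_distrib power2_eq_square)
    qed
    finally show "L \<le> r - z k \<bullet> u + (z k \<bullet> x0 - T k / 2 * (norm (z k))\<^sup>2)"
      using T_pos[OF k] by simp
  qed
  show ?thesis
    unfolding T_def[symmetric]
  proof (intro conjI impI allI)
    fix k :: nat assume \<theta>1: "\<forall>k. \<theta> k = 1" and k: "1 \<le> k"
    have T: "T k = (\<Sum>i<k. t i)"
      by (simp add: T_def \<theta>1)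
    define S where "S = (\<Sum>i<k. t i * F (Suc i))"
    have "(\<Sum>i<k. ereal (t i) * f (x (Suc i))) / ereal (\<Sum>i<k. t i) = ereal (S / T k)"
      using T_pos[OF k] by (simp add: F T S_def)
    also have "\<dots> \<le> - conjugate f (z k) + ereal (z k \<bullet> x0 - T k / 2 * (norm (z k))\<^sup>2)"
    proof (rule conj[OF k])
      fix u r assume r: "f u = ereal r"
      \<comment> \<open>Here \<open>y i = w i\<close>, so the step inequality multiplied by
        \<open>t i\<close> matches \<open>w_gap\<close> exactly.\<close>
      have "t i * (F (Suc i) - r) \<le> (norm (w i - u))\<^sup>2 / 2 - (norm (w (Suc i) - u))\<^sup>2 / 2" for i
      proof -
        have "F (Suc i) - r \<le> g i \<bullet> (w i - u) - t i / 2 * (norm (g i))\<^sup>2"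
          using F_step[OF r, of i] y[of i] by (simp add: \<theta>1 inner_diff_right)
        then have "t i * (F (Suc i) - r) \<le> t i * (g i \<bullet> (w i - u) - t i / 2 * (norm (g i))\<^sup>2)"
          using pos(3) by (intro mult_left_mono) (auto intro: less_imp_le)
        then show ?thesis
          unfolding w_gap by (simp add: \<theta>1 algebra_simps power2_eq_square)
      qed
      then have "(\<Sum>i<k. t i * (F (Suc i) - r))
          \<le> (\<Sum>i<k. (norm (w i - u))\<^sup>2 / 2 - (norm (w (Suc i) - u))\<^sup>2 / 2)"
        by (intro sum_mono)
      also have "\<dots> = (norm (x0 - u))\<^sup>2 / 2 - (norm (w k - u))\<^sup>2 / 2"
        using sum_lessThan_telescope'[of "\<lambda>i. (norm (w i - u))\<^sup>2 / 2" k] by (simp add: w_def)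
      finally show "T k * (S / T k - r) \<le> (norm (x0 - u))\<^sup>2 / 2 - (norm (w k - u))\<^sup>2 / 2"
        using T_pos[OF k]
        by (simp add: right_diff_distrib S_def sum_subtractf flip: sum_distrib_right T)
    qed
    finally show "(\<Sum>i<k. ereal (t i) * f (x (Suc i))) / ereal (\<Sum>i<k. t i)
        \<le> - conjugate f (z k) + ereal (z k \<bullet> x0 - T k / 2 * (norm (z k))\<^sup>2)" .
  next
    fix k :: nat assume "\<forall>k. T k = (1 - \<theta> k) * (\<Sum>i\<le>k. t i / \<theta> i)" and k: "1 \<le> k"
    then have T1: "T j = (1 - \<theta> j) * T (Suc j)" for j
      by (simp add: T_def lessThan_Suc_atMost)
    \<comment> \<open>The increment of \<open>T\<close> is the fraction \<open>\<theta> j\<close> of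
      its new value, so \<open>T1\<close> and \<open>T2\<close> give the weights of
      \<open>x j\<close> and \<open>u\<close> after multiplication by
      \<open>T (Suc j)\<close>.\<close>
    have T2: "t j / \<theta> j = \<theta> j * T (Suc j)" for j
    proof -
      have "T (Suc j) = T j + t j / \<theta> j" by (simp add: T_def)
      then show ?thesis using T1[of j] by (simp add: algebra_simps)
    qed
    \<comment> \<open>The induction starts at 0, where \<open>T 0 = 0\<close> removes the arbitrary
      value \<open>F 0\<close>.\<close>
    have main: "T k * (F k - r) \<le> (norm (x0 - u))\<^sup>2 / 2 - (norm (w k - u))\<^sup>2 / 2"
      if r: "f u = ereal r" for u r k
    proof (induction k)
      case 0
      then show ?case by (simp add: T_def w_def)
    next
      case (Suc j)
      define A where "A v = F (Suc j) + g j \<bullet> (v - y j) + t j / 2 * (norm (g j))\<^sup>2" for v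
      have Au: "A u \<le> r"
        unfolding A_def by (rule F_step[OF r])
      \<comment> \<open>\<open>f x0\<close> may be infinite, but it enters with the weight \<open>1 - \<theta> 0 = 0\<close>.\<close>
      have Ax: "(1 - \<theta> j) * A (x j) \<le> (1 - \<theta> j) * F j"
      proof (cases j)
        case (Suc i)
        then have "A (x j) \<le> F j"
          unfolding A_def by (intro F_step) (simp add: F)
        then show ?thesis
          using pos(2)[of j] by (intro mult_left_mono) auto
      qed (simp add: \<theta>0)
      \<comment> \<open>By the interpolation formula, the combination of \<open>x j\<close> and
        \<open>u\<close> with these weights minus \<open>y j\<close> is
        \<open>- \<theta> j *\<^sub>R (w j - u)\<close>.\<close>
      have "(1 - \<theta> j) * A (x j) + \<theta> j * A u
          = F (Suc j) - \<theta> j * (g j \<bullet> (w j - u)) + t j / 2 * (norm (g j))\<^sup>2"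
        unfolding A_def y by (simp add: algebra_simps add_divide_distrib diff_divide_distrib)
      moreover have "\<theta> j * A u \<le> \<theta> j * r"
        using Au pos(1)[of j] by simp
      ultimately have "F (Suc j) - r
          \<le> (1 - \<theta> j) * (F j - r) + \<theta> j * (g j \<bullet> (w j - u)) - t j / 2 * (norm (g j))\<^sup>2"
        using Ax by (simp add: algebra_simps)
      then have "T (Suc j) * (F (Suc j) - r) \<le> T (Suc j) *
          ((1 - \<theta> j) * (F j - r) + \<theta> j * (g j \<bullet> (w j - u)) - t j / 2 * (norm (g j))\<^sup>2)"
        using T_pos[of "Suc j"] by (intro mult_left_mono) auto
      also have "\<dots> = T j * (F j - r) + t j / \<theta> j * (g j \<bullet> (w j - u))
          - (T (Suc j) * t j) / 2 * (norm (g j))\<^sup>2"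
        unfolding T2 T1[of j] by (simp add: algebra_simps)
      \<comment> \<open>Equivalently, \<open>T (Suc j) = t j / (\<theta> j)\<^sup>2\<close>; this
        makes the coefficient of the squared norm of \<open>g j\<close> agree with the one in
        \<open>w_gap\<close>.\<close>
      also have "T (Suc j) * t j = (t j / \<theta> j)\<^sup>2"
        using T2[of j] pos(1)[of j] by (simp add: power2_eq_square field_simps)
      finally show ?case
        using Suc w_gap[of j u] by linarith
    qed
    obtain j where "k = Suc j"
      using k by (cases k) auto
    then show "f (x k) \<le> - conjugate f (z k) + ereal (z k \<bullet> x0 - T k / 2 * (norm (z k))\<^sup>2)"
      using conj[OF k main] F by simp
  qed
qed

end
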